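(* Let $\mathcal{L}(\mathbf{x},\boldsymbol{\lambda},t)$ be a scalar function of $\mathbf{x}\in\mathbb{R}^n$, $\boldsymbol{\lambda}\in\mathbb{R}^m$ and $t\in\mathbb{R}$, and let $\mathbf{M}_{\mathbf{x}}(\mathbf{x})\in\mathbb{R}^{n\times n}$ and $\mathbf{M}_{\boldsymbol{\lambda}}(\boldsymbol{\lambda})\in\mathbb{R}^{m\times m}$ be symmetric positive definite metrics. Suppose $\mathcal{L}$ is geodesically strongly convex over $\mathbf{x}$ in the metric $\mathbf{M}_{\mathbf{x}}$ and geodesically strongly concave over $\boldsymbol{\lambda}$ in the metric $\mathbf{M}_{\boldsymbol{\lambda}}$. Then the geodesic primal-dual dynamics $$\mathbf{M}_{\mathbf{x}}(\mathbf{x})\,\dot{\mathbf{x}}=-\nabla_{\mathbf{x}}\mathcal{L}(\mathbf{x},\boldsymbol{\lambda},t),\qquad \mathbf{M}_{\boldsymbol{\lambda}}(\boldsymbol{\lambda})\,\dot{\boldsymbol{\lambda}}=\nabla_{\boldsymbol{\lambda}}\mathcal{L}(\mathbf{x},\boldsymbol{\lambda},t)$$ is globally contracting in the metric $$\mathbf{M}(\mathbf{x},\boldsymbol{\lambda})=\begin{bmatrix}\mathbf{M}_{\mathbf{x}}(\mathbf{x})&\mathbf{0}\\\mathbf{0}&\mathbf{M}_{\boldsymbol{\lambda}}(\boldsymbol{\lambda})\end{bmatrix}.$$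
   Context: All functions are assumed sufficiently smooth that derivatives of the necessary order exist and are continuous. A metric is a matrix-valued function with symmetric positive definite values. Contraction: a system $\dot{\mathbf{z}}=\mathbf{h}(\mathbf{z},t)$ is (globally) contracting in the metric $\mathbf{M}$ if there is a rate $\alpha>0$ such that for all $t$ and $\mathbf{z}$, $\dot{\mathbf{M}}+\mathbf{A}^\top\mathbf{M}+\mathbf{M}\mathbf{A}\preceq-2\alpha\mathbf{M}$, where $\mathbf{A}=\frac{\partial\mathbf{h}}{\partial\mathbf{z}}$ and $\dot{\mathbf{M}}=\sum_i\frac{\partial\mathbf{M}}{\partial z_i}h_i(\mathbf{z},t)$. Here $\mathbf{z}=[\mathbf{x}^\top,\boldsymbol{\lambda}^\top]^\top$. Riemannian Hessian: for a function $f(\mathbf{x})$ and metric $\mathbf{M}(\mathbf{x})$, $H_{ij}=\frac{\partial^2 f}{\partial x_i\partial x_j}-\sum_k\Gamma_{ij}^k\frac{\partial f}{\partial x_k}$ with $\Gamma_{ij}^m=\frac12\sum_k M^{mk}\left(\frac{\partial M_{ik}}{\partial x_j}+\frac{\partial M_{jk}}{\partial x_i}-\frac{\partial M_{ij}}{\partial x_k}\right)$ and $M^{ij}=(\mathbf{M}^{-1})_{ij}$. The function $f$ is geodesically $\alpha$-strongly convex in $\mathbf{M}$ ($\alpha>0$) if $\mathbf{H}(\mathbf{x})\succeq\alpha\mathbf{M}(\mathbf{x})$ for all $\mathbf{x}$; it is geodesically strongly concave if $-f$ is geodesically strongly convex. "$\mathcal{L}$ is geodesically strongly convex over $\mathbf{x}$"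 means that there is a constant $\alpha_1>0$ such that $\mathbf{x}\mapsto\mathcal{L}(\mathbf{x},\boldsymbol{\lambda},t)$ is geodesically $\alpha_1$-strongly convex in $\mathbf{M}_{\mathbf{x}}$ for every $(\boldsymbol{\lambda},t)$; "geodesically strongly concave over $\boldsymbol{\lambda}$" means that there is a constant $\alpha_2>0$ such that $\boldsymbol{\lambda}\mapsto-\mathcal{L}(\mathbf{x},\boldsymbol{\lambda},t)$ is geodesically $\alpha_2$-strongly convex in $\mathbf{M}_{\boldsymbol{\lambda}}$ for every $(\mathbf{x},t)$. *)

theory Defs
  imports "HOL-Analysis.Analysis"
begin

section \<open>Partial derivatives and smoothness\<close>

definition partial :: "'k::finite \<Rightarrow> (real^'k \<Rightarrow> real) \<Rightarrow> real^'k \<Rightarrow> real" where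
  "partial i f x = deriv (\<lambda>s. f (x + s *\<^sub>R axis i 1)) 0"

definition C1_fun :: "(real^'k::finite \<Rightarrow> real) \<Rightarrow> bool" where
  "C1_fun f \<longleftrightarrow> (\<forall>x. f differentiable (at x)) \<and> (\<forall>i. continuous_on UNIV (partial i f))"

definition C2_fun :: "(real^'k::finite \<Rightarrow> real) \<Rightarrow> bool" where
  "C2_fun f \<longleftrightarrow> C1_fun f \<and> (\<forall>i. C1_fun (partial i f))"

definition grad :: "(real^'k::finite \<Rightarrow> real) \<Rightarrow> real^'k \<Rightarrow> real^'k" where
  "grad f x = (\<chi> i. partial i f x)"

section \<open>Definite matrices and metrics\<close>

definition pos_def :: "real^'k^'k::finite \<Rightarrow> bool" where
  "pos_def A \<longleftrightarrow> transpose A = A \<and> (\<forall>v. v \<noteq> 0 \<longrightarrow> 0 < v \<bullet> (A *v v))"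

definition pos_semidef :: "real^'k^'k::finite \<Rightarrow> bool" where
  "pos_semidef A \<longleftrightarrow> transpose A = A \<and> (\<forall>v. 0 \<le> v \<bullet> (A *v v))"

definition loewner_le :: "real^'k^'k::finite \<Rightarrow> real^'k^'k \<Rightarrow> bool"  (infix "\<preceq>" 50) where
  "A \<preceq> B \<longleftrightarrow> pos_semidef (B - A)"

definition riemannian_metric :: "(real^'k::finite \<Rightarrow> real^'k^'k) \<Rightarrow> bool" where
  "riemannian_metric M \<longleftrightarrow> (\<forall>x. pos_def (M x)) \<and> (\<forall>i j. C1_fun (\<lambda>x. M x $ i $ j))"

section \<open>Riemannian Hessian and geodesic convexity\<close>

text \<open>\<open>christoffel M m i j x\<close> has the upper index \<open>m\<close> and the lower indices \<open>i\<close>, \<open>j\<close>.\<close>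

definition christoffel ::
  "(real^'k::finite \<Rightarrow> real^'k^'k) \<Rightarrow> 'k \<Rightarrow> 'k \<Rightarrow> 'k \<Rightarrow> real^'k \<Rightarrow> real" where
  "christoffel M m i j x =
    1/2 * (\<Sum>k\<in>UNIV. matrix_inv (M x) $ m $ k *
      (partial j (\<lambda>y. M y $ i $ k) x + partial i (\<lambda>y. M y $ j $ k) x
       - partial k (\<lambda>y. M y $ i $ j) x))"

definition riemannian_hessian ::
  "(real^'k::finite \<Rightarrow> real^'k^'k) \<Rightarrow> (real^'k \<Rightarrow> real) \<Rightarrow> real^'k \<Rightarrow> real^'k^'k" where
  "riemannian_hessian M f x =
    (\<chi> i j. partial i (partial j f) x - (\<Sum>k\<in>UNIV. christoffel M k i j x * partial k f x))"

definition geodesically_strongly_convex ::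
  "real \<Rightarrow> (real^'k::finite \<Rightarrow> real^'k^'k) \<Rightarrow> (real^'k \<Rightarrow> real) \<Rightarrow> bool" where
  "geodesically_strongly_convex \<alpha> M f \<longleftrightarrow>
    0 < \<alpha> \<and> (\<forall>x. \<alpha> *\<^sub>R M x \<preceq> riemannian_hessian M f x)"

section \<open>Contraction\<close>

definition metric_rate ::
  "(real^'k::finite \<Rightarrow> real \<Rightarrow> real^'k) \<Rightarrow> (real^'k \<Rightarrow> real^'k^'k) \<Rightarrow> real^'k \<Rightarrow> real \<Rightarrow> real^'k^'k" where
  "metric_rate h M z t = (\<chi> a b. \<Sum>i\<in>UNIV. partial i (\<lambda>y. M y $ a $ b) z * h z t $ i)"

text \<open>The differentiability conjunct ensures that \<^const>\<open>jacobian\<close>, which is unspecified at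
  points of non-differentiability, is the actual Jacobian matrix of the vector field.\<close>

definition contracting ::
  "(real^'k::finite \<Rightarrow> real \<Rightarrow> real^'k) \<Rightarrow> (real^'k \<Rightarrow> real^'k^'k) \<Rightarrow> bool" where
  "contracting h M \<longleftrightarrow>
    riemannian_metric M \<and>
    (\<forall>t z. (\<lambda>y. h y t) differentiable (at z)) \<and>
    (\<exists>\<alpha>>0. \<forall>t z. let A = jacobian (\<lambda>y. h y t) (at z) in
       metric_rate h M z t + transpose A ** M z + M z ** A \<preceq> (- 2 * \<alpha>) *\<^sub>R M z)"

section \<open>Primal-dual dynamics\<close>

text \<open>The state \<open>z = [x\<^sup>T, \<lambda>\<^sup>T]\<^sup>T\<close> is a vector indexed by the disjoint sum of the index types.\<close>

definition stack :: "real^'n::finite \<Rightarrow> real^'m::finite \<Rightarrow> real^('n + 'm)" where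
  "stack x l = (\<chi> i. case i of Inl a \<Rightarrow> x $ a | Inr b \<Rightarrow> l $ b)"

definition primal :: "real^('n::finite + 'm::finite) \<Rightarrow> real^'n" where
  "primal z = (\<chi> a. z $ Inl a)"

definition dual :: "real^('n::finite + 'm::finite) \<Rightarrow> real^'m" where
  "dual z = (\<chi> b. z $ Inr b)"

definition block_diag ::
  "real^'n^'n::finite \<Rightarrow> real^'m^'m::finite \<Rightarrow> real^('n + 'm)^('n + 'm)" where
  "block_diag P Q = (\<chi> i j. case (i, j) of
      (Inl a, Inl b) \<Rightarrow> P $ a $ b
    | (Inr a, Inr b) \<Rightarrow> Q $ a $ b
    | _ \<Rightarrow> 0)"

text \<open>\<open>h\<close> is the vector field of the implicitly given system
  \<open>Mx(x) x' = - grad\<^sub>x L(x, \<lambda>, t)\<close>, \<open>Ml(\<lambda>) \<lambda>' = grad\<^sub>\<lambda> L(x, \<lambda>, t)\<close>.\<close>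

definition primal_dual_field ::
  "(real^'n::finite \<Rightarrow> real^'n^'n) \<Rightarrow> (real^'m::finite \<Rightarrow> real^'m^'m) \<Rightarrow>
   (real^'n \<Rightarrow> real^'m \<Rightarrow> real \<Rightarrow> real) \<Rightarrow> (real^('n + 'm) \<Rightarrow> real \<Rightarrow> real^('n + 'm)) \<Rightarrow> bool" where
  "primal_dual_field Mx Ml L h \<longleftrightarrow>
    (\<forall>x l t. Mx x *v primal (h (stack x l) t) = - grad (\<lambda>y. L y l t) x \<and>
             Ml l *v dual (h (stack x l) t) = grad (\<lambda>k. L x k t) l)"

lemma primal_stack [simp]: "primal (stack x l) = x"
  and dual_stack [simp]: "dual (stack x l) = l"
  and stack_primal_dual [simp]: "stack (primal z) (dual z) = z"
  by (auto simp: primal_def dual_def stack_def vec_eq_iff split: sum.splits)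

lemma pos_def_imp_invertible:
  assumes "pos_def A"
  shows "invertible A"
proof -
  have "x = 0" if "A *v x = 0" for x
    using assms that unfolding pos_def_def by (metis inner_zero_right less_irrefl)
  then show ?thesis
    using matrix_left_invertible_ker invertible_left_inverse by blast
qed

text \<open>The implicit equations determine the vector field uniquely.\<close>

lemma ex1_primal_dual_field:
  assumes "riemannian_metric Mx" "riemannian_metric Ml"
  shows "\<exists>!h. primal_dual_field Mx Ml L h"
proof -
  define F where "F z t = stack
      (matrix_inv (Mx (primal z)) *v (- grad (\<lambda>y. L y (dual z) t) (primal z)))
      (matrix_inv (Ml (dual z)) *v grad (\<lambda>k. L (primal z) k t) (dual z))" for z t
  have inv: "invertible (Mx x)" "invertible (Ml l)" for x l
    using assms by (auto simp: riemannian_metric_def intro: pos_def_imp_invertible)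
  have solve: "A *v u = b \<longleftrightarrow> u = matrix_inv A *v b" if "invertible A"
    for A :: "real^'k^'k::finite" and u b
    using someI_ex[OF that[unfolded invertible_def], folded matrix_inv_def]
    by (metis matrix_vector_mul_assoc matrix_vector_mul_lid)
  have eq: "primal_dual_field Mx Ml L h \<longleftrightarrow> h = F" for h
  proof -
    have "primal_dual_field Mx Ml L h \<longleftrightarrow>
        (\<forall>x l t. h (stack x l) t = F (stack x l) t)"
      unfolding primal_dual_field_def
      by (simp add: F_def solve inv) (metis primal_stack dual_stack stack_primal_dual)
    also have "\<dots> \<longleftrightarrow> h = F"
      unfolding fun_eq_iff by (metis stack_primal_dual)
    finally show ?thesis .
  qed
  show ?thesis by (simp add: eq)
qed

end

theory Submission
  imports Defs
begin

text \<open>Differentiating \<open>M h = g\<close> eliminates the Jacobian of \<open>h\<close>: the quadratic form of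
  \<open>M' + A\<^sup>T M + M A\<close> is twice that of the Jacobian of \<open>g\<close> minus twice the Christoffel symbols of the
  first kind of \<open>M\<close> contracted with \<open>h\<close>. If \<open>M h = - grad f\<close>, this is \<open>- 2\<close> times the Riemannian
  Hessian of \<open>f\<close>. For the block metric the Christoffel symbols split into the two blocks, with
  \<open>f = L\<close> and \<open>f = - L\<close> respectively, while the mixed second derivatives of \<open>L\<close> enter \<open>g\<close> with
  opposite signs and cancel. Hence \<open>min \<alpha>\<^sub>1 \<alpha>\<^sub>2\<close> is a contraction rate.\<close>

section \<open>Partial derivatives\<close>

text \<open>Chain rule along a coordinate line. The parameter \<open>s\<close> is arbitrary, not
  just 0, because the mean value theorem will need the derivative along a whole segment.\<close>

lemma has_real_derivative_axis:
  fixes f :: "real^'k::finite \<Rightarrow> real"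
  assumes "(f has_derivative f') (at (x + s *\<^sub>R axis i 1))"
  shows "((\<lambda>r. f (x + r *\<^sub>R axis i 1)) has_real_derivative f' (axis i 1)) (at s)"
proof -
  have *: "((\<lambda>r::real. x + r *\<^sub>R axis i (1::real)) has_derivative (\<lambda>r. r *\<^sub>R axis i 1)) (at s)"
    by (auto intro!: derivative_eq_intros)
  have "((\<lambda>r. f (x + r *\<^sub>R axis i 1)) has_derivative (\<lambda>r. f' (r *\<^sub>R axis i 1))) (at s)"
    using has_derivative_compose[OF * assms] .
  moreover have "(\<lambda>r. f' (r *\<^sub>R axis i 1)) = (*) (f' (axis i 1))"
    using has_derivative_linear[OF assms] by (simp add: fun_eq_iff linear_scale)
  ultimately show ?thesis
    by (simp add: has_field_derivative_def)
qed

text \<open>Since \<open>partial\<close> is a \<open>deriv\<close> along a line, it is evaluated by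
  applying the total derivative to a basis vector; this is how product and sign rules for partial
  derivatives are obtained below.\<close>

lemma partial_eq:
  assumes "(f has_derivative f') (at x)"
  shows "partial i f x = f' (axis i 1)"
  unfolding partial_def using assms
  by (intro DERIV_imp_deriv has_real_derivative_axis) simp

lemma has_real_derivative_partial:
  assumes "\<And>x. f differentiable (at x)"
  shows "((\<lambda>s. f (x + s *\<^sub>R axis i 1)) has_real_derivative partial i f (x + s *\<^sub>R axis i 1)) (at s)"
proof -
  obtain f' where f': "(f has_derivative f') (at (x + s *\<^sub>R axis i 1))"
    using assms by (auto simp: differentiable_def)
  show ?thesis
    using has_real_derivative_axis[OF f'] by (simp add: partial_eq[OF f'])
qed

lemma partial_uminus:
  fixes f :: "real^'k::finite \<Rightarrow> real"
  assumes "f differentiable (at x)"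
  shows "partial i (\<lambda>y. - f y) x = - partial i f x"
proof -
  have *: "(f has_derivative frechet_derivative f (at x)) (at x)"
    using assms by (simp add: frechet_derivative_works)
  show ?thesis
    using partial_eq[OF has_derivative_minus[OF *]] partial_eq[OF *] by simp
qed

section \<open>Symmetry of second partial derivatives\<close>

text \<open>Two applications of the mean value theorem: first in direction \<open>i\<close> to the
  increment of \<open>f\<close> in direction \<open>j\<close>, then in direction \<open>j\<close> to
  \<open>partial i f\<close>.\<close>

lemma second_difference:
  fixes f :: "real^'k::finite \<Rightarrow> real"
  assumes f: "\<And>x. f differentiable (at x)" and fi: "\<And>x. partial i f differentiable (at x)"
    and "0 < (h::real)"
  obtains a b where "0 < a" "a < h" "0 < b" "b < h"
    "f (x + h *\<^sub>R axis i 1 + h *\<^sub>R axis j 1) - f (x + h *\<^sub>R axis i 1) - f (x + h *\<^sub>R axis j 1) + f x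
      = h * h * partial j (partial i f) (x + a *\<^sub>R axis i 1 + b *\<^sub>R axis j 1)"
proof -
  \<comment> \<open>The second difference of \<open>f\<close> equals \<open>?p h - ?p 0\<close>: the
    increment in direction \<open>j\<close> is regarded as a function of the displacement in
    direction \<open>i\<close>.\<close>
  let ?p = "\<lambda>s. f (x + h *\<^sub>R axis j 1 + s *\<^sub>R axis i 1) - f (x + s *\<^sub>R axis i 1)"
  have "\<exists>a. 0 < a \<and> a < h \<and> ?p h - ?p 0 = (h - 0) *
      (partial i f (x + h *\<^sub>R axis j 1 + a *\<^sub>R axis i 1) - partial i f (x + a *\<^sub>R axis i 1))"
    using \<open>0 < h\<close> by (intro MVT2) (auto intro!: DERIV_diff has_real_derivative_partial f)
  then obtain a where a: "0 < a" "a < h" "?p h - ?p 0 = h *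
      (partial i f (x + h *\<^sub>R axis j 1 + a *\<^sub>R axis i 1) - partial i f (x + a *\<^sub>R axis i 1))"
    by auto
  let ?q = "\<lambda>s. partial i f (x + a *\<^sub>R axis i 1 + s *\<^sub>R axis j 1)"
  have "\<exists>b. 0 < b \<and> b < h \<and> ?q h - ?q 0 = (h - 0) *
      partial j (partial i f) (x + a *\<^sub>R axis i 1 + b *\<^sub>R axis j 1)"
    using \<open>0 < h\<close> by (intro MVT2) (auto intro!: has_real_derivative_partial fi)
  then obtain b where "0 < b" "b < h" "?q h - ?q 0 = h *
      partial j (partial i f) (x + a *\<^sub>R axis i 1 + b *\<^sub>R axis j 1)"
    by auto
  with a show ?thesis
    by (intro that[of a b]) (simp_all add: algebra_simps)
qed

text \<open>Schwarz's theorem. It is what later lets the mixed derivatives of \<open>L\<close> in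
  the primal and dual variables cancel.\<close>

lemma partial_commute:
  fixes f :: "real^'k::finite \<Rightarrow> real"
  assumes "C2_fun f"
  shows "partial i (partial j f) x = partial j (partial i f) x"
proof (rule ccontr)
  assume ne: "partial i (partial j f) x \<noteq> partial j (partial i f) x"
  \<comment> \<open>Half the gap: two numbers within distance \<open>e\<close> of the two different
    values cannot coincide.\<close>
  define e where "e = dist (partial i (partial j f) x) (partial j (partial i f) x) / 2"
  have "e > 0" using ne by (simp add: e_def)
  have d: "\<And>x. f differentiable (at x)" "\<And>i x. partial i f differentiable (at x)"
    and c: "\<And>i j. isCont (partial i (partial j f)) x"
    using assms by (auto simp: C2_fun_def C1_fun_def continuous_on_eq_continuous_at)
  obtain r s where "r > 0" "s > 0"
    and r: "\<And>y. dist y x < r \<Longrightarrow> dist (partial i (partial j f) y) (partial i (partial j f) x) < e"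
    and s: "\<And>y. dist y x < s \<Longrightarrow> dist (partial j (partial i f) y) (partial j (partial i f) x) < e"
    using c[of i j] c[of j i] \<open>e > 0\<close> unfolding continuous_at_eps_delta by metis
  \<comment> \<open>The intermediate points are displaced by two axis vectors of length below
    \<open>h\<close> each, so \<open>2 * h\<close> must fit into both radii.\<close>
  define h where "h = min r s / 2"
  have h: "h > 0" "2 * h \<le> r" "2 * h \<le> s"
    using \<open>r > 0\<close> \<open>s > 0\<close> by (auto simp: h_def)
  have near: "dist (x + a *\<^sub>R axis p 1 + b *\<^sub>R axis q 1) x < 2 * h"
    if "0 < a" "a < h" "0 < b" "b < h" for a b p q
  proof -
    have "norm (a *\<^sub>R axis p 1 + b *\<^sub>R axis q (1::real)) \<le> a + b"
      using that by (intro norm_triangle_le) (simp add: norm_axis_1)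
    then show ?thesis
      using that by (simp add: dist_norm add.assoc)
  qed
  \<comment> \<open>The second difference is symmetric in \<open>i\<close> and \<open>j\<close>, so the two mixed partials agree at two
    points arbitrarily close to \<open>x\<close>.\<close>
  obtain a b where ab: "0 < a" "a < h" "0 < b" "b < h"
    "f (x + h *\<^sub>R axis i 1 + h *\<^sub>R axis j 1) - f (x + h *\<^sub>R axis i 1) - f (x + h *\<^sub>R axis j 1) + f x
      = h * h * partial j (partial i f) (x + a *\<^sub>R axis i 1 + b *\<^sub>R axis j 1)"
    by (rule second_difference[OF d h(1)])
  obtain a' b' where ab': "0 < a'" "a' < h" "0 < b'" "b' < h"
    "f (x + h *\<^sub>R axis j 1 + h *\<^sub>R axis i 1) - f (x + h *\<^sub>R axis j 1) - f (x + h *\<^sub>R axis i 1) + f x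
      = h * h * partial i (partial j f) (x + a' *\<^sub>R axis j 1 + b' *\<^sub>R axis i 1)"
    by (rule second_difference[OF d h(1)])
  have "h * h * partial j (partial i f) (x + a *\<^sub>R axis i 1 + b *\<^sub>R axis j 1)
      = h * h * partial i (partial j f) (x + a' *\<^sub>R axis j 1 + b' *\<^sub>R axis i 1)"
    using ab(5) ab'(5) by (simp add: algebra_simps)
  then have "partial j (partial i f) (x + a *\<^sub>R axis i 1 + b *\<^sub>R axis j 1)
      = partial i (partial j f) (x + a' *\<^sub>R axis j 1 + b' *\<^sub>R axis i 1)"
    using h(1) by simp
  moreover have "dist (partial j (partial i f) (x + a *\<^sub>R axis i 1 + b *\<^sub>R axis j 1))
      (partial j (partial i f) x) < e"
    using near[OF ab(1-4), of i j] h(3) by (intro s) linarith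
  moreover have "dist (partial i (partial j f) (x + a' *\<^sub>R axis j 1 + b' *\<^sub>R axis i 1))
      (partial i (partial j f) x) < e"
    using near[OF ab'(1-4), of j i] h(2) by (intro r) linarith
  ultimately show False
    unfolding e_def dist_real_def by (simp add: abs_if field_simps split: if_splits)
qed

section \<open>Linear systems with differentiable coefficients\<close>

lemma differentiable_vec_nth_iff:
  fixes f :: "'a::real_normed_vector \<Rightarrow> real^'k::finite"
  shows "f differentiable (at x) \<longleftrightarrow> (\<forall>i. (\<lambda>y. f y $ i) differentiable (at x))"
  unfolding differentiable_componentwise_within[of f]
  by (auto simp: Basis_vec_def inner_axis)

text \<open>The determinant is a polynomial in the entries; sum and product rules apply to its
  Leibniz expansion and produce the derivative.\<close>

lemma differentiable_det:
  fixes A :: "'a::real_normed_vector \<Rightarrow> real^'k^'k::finite"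
  assumes "\<And>i j. (\<lambda>y. A y $ i $ j) differentiable (at x)"
  shows "(\<lambda>y. det (A y)) differentiable (at x)"
proof -
  obtain D where "\<And>i j. ((\<lambda>y. A y $ i $ j) has_derivative D i j) (at x)"
    using assms unfolding differentiable_def by metis
  then show ?thesis
    unfolding differentiable_def det_def
    by (intro exI) (rule has_derivative_sum has_derivative_mult_right has_derivative_prod | assumption)+
qed

text \<open>Cramer's rule writes each coordinate of \<open>u\<close> as a quotient of determinants
  with differentiable entries and nonzero denominator. This serves to differentiate a vector field
  that is given only implicitly.\<close>

lemma differentiable_linear_solution:
  fixes A :: "'a::real_normed_vector \<Rightarrow> real^'k^'k::finite"
  assumes A: "\<And>i j. (\<lambda>y. A y $ i $ j) differentiable (at x)"
    and b: "\<And>i. (\<lambda>y. b y $ i) differentiable (at x)"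
    and inv: "\<And>y. invertible (A y)"
    and eq: "\<And>y. A y *v u y = b y"
  shows "u differentiable (at x)"
proof -
  have det: "det (A y) \<noteq> 0" for y
    using inv by (simp add: invertible_det_nz)
  have u: "u = (\<lambda>y. \<chi> k. det (\<chi> i j. if j = k then b y $ i else A y $ i $ j) / det (A y))"
    using cramer[OF det] eq by blast
  have num: "(\<lambda>y. det (\<chi> i j. if j = k then b y $ i else A y $ i $ j)) differentiable (at x)" for k
  proof (rule differentiable_det)
    fix i j
    show "(\<lambda>y. (\<chi> i j. if j = k then b y $ i else A y $ i $ j) $ i $ j) differentiable (at x)"
      using A b by (cases "j = k") simp_all
  qed
  show ?thesis
    unfolding differentiable_vec_nth_iff
    by (subst u) (simp add: differentiable_divide num differentiable_det A det)
qed


section \<open>Quadratic forms of the Hessian and of the contraction matrix\<close>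

lemma inner_matrix_vector:
  fixes A :: "real^'k^'k::finite"
  shows "v \<bullet> (A *v v) = (\<Sum>i\<in>UNIV. \<Sum>j\<in>UNIV. v $ i * v $ j * A $ i $ j)"
  by (simp add: inner_vec_def matrix_vector_mult_def sum_distrib_left ac_simps)

text \<open>Transpose \<open>A ** matrix_inv A = mat 1\<close> and use the symmetry of
  \<open>A\<close>. The transpose appears because the Christoffel term of the Hessian sums over the
  first index of the inverse metric.\<close>

lemma transpose_matrix_inv_cancel:
  assumes "pos_def A"
  shows "transpose (matrix_inv A) *v (A *v w) = w"
proof -
  have "invertible A" and sym: "transpose A = A"
    using assms by (simp_all add: pos_def_imp_invertible pos_def_def)
  then have "A ** matrix_inv A = mat 1"
    unfolding invertible_def matrix_inv_def by (metis (mono_tags, lifting) someI_ex)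
  then have "transpose (A ** matrix_inv A) = mat 1"
    by simp
  then have "transpose (matrix_inv A) ** A = mat 1"
    by (simp only: matrix_transpose_mul sym)
  then show ?thesis
    by (simp add: matrix_vector_mul_assoc)
qed

text \<open>The vector \<open>w\<close> is the negative Riemannian gradient of \<open>f\<close>.
  Contracting the inverse metric inside the Christoffel symbols with the partial derivatives of
  \<open>f\<close> gives \<open>- w\<close>, which leaves symbols of the first kind contracted with
  \<open>w\<close> and no inverse.\<close>

lemma riemannian_hessian_quadratic:
  fixes M :: "real^'k::finite \<Rightarrow> real^'k^'k"
  assumes M: "pos_def (M x)" and w: "M x *v w = - grad f x"
  shows "v \<bullet> (riemannian_hessian M f x *v v) =
    (\<Sum>i\<in>UNIV. \<Sum>j\<in>UNIV. v $ i * v $ j * partial j (partial i f) x)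
    + 1/2 * (\<Sum>i\<in>UNIV. \<Sum>j\<in>UNIV. \<Sum>b\<in>UNIV. v $ i * v $ j * w $ b *
        (partial j (\<lambda>y. M y $ i $ b) x + partial i (\<lambda>y. M y $ j $ b) x - partial b (\<lambda>y. M y $ i $ j) x))"
proof -
  let ?c = "\<lambda>i j b. partial j (\<lambda>y. M y $ i $ b) x + partial i (\<lambda>y. M y $ j $ b) x
    - partial b (\<lambda>y. M y $ i $ j) x"
  have "M x *v (- w) = grad f x"
    by (simp add: linear_neg[OF matrix_vector_mul_linear] w)
  then have "(transpose (matrix_inv (M x)) *v grad f x) $ b = - w $ b" for b
    using transpose_matrix_inv_cancel[OF M, of "- w"] by simp
  then have inv: "(\<Sum>k\<in>UNIV. matrix_inv (M x) $ k $ b * partial k f x) = - w $ b" for b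
    by (simp add: matrix_vector_mult_def transpose_def grad_def)
  have "(\<Sum>k\<in>UNIV. christoffel M k i j x * partial k f x) = - 1/2 * (\<Sum>b\<in>UNIV. w $ b * ?c i j b)" for i j
  proof -
    have "(\<Sum>k\<in>UNIV. christoffel M k i j x * partial k f x)
        = (\<Sum>k\<in>UNIV. \<Sum>b\<in>UNIV. 1/2 * (?c i j b * (matrix_inv (M x) $ k $ b * partial k f x)))"
      unfolding christoffel_def sum_distrib_left sum_distrib_right
      by (intro sum.cong refl) (simp add: ac_simps)
    also have "\<dots> = (\<Sum>b\<in>UNIV. \<Sum>k\<in>UNIV. 1/2 * (?c i j b * (matrix_inv (M x) $ k $ b * partial k f x)))"
      by (rule sum.swap)
    also have "\<dots> = (\<Sum>b\<in>UNIV. 1/2 * (?c i j b * - w $ b))"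
      unfolding inv[symmetric] sum_distrib_left ..
    finally show ?thesis
      by (simp add: sum_distrib_left sum_negf mult.commute)
  qed
  then have "v \<bullet> (riemannian_hessian M f x *v v) = (\<Sum>i\<in>UNIV. \<Sum>j\<in>UNIV.
      v $ i * v $ j * (partial i (partial j f) x + 1/2 * (\<Sum>b\<in>UNIV. w $ b * ?c i j b)))"
    by (simp add: inner_matrix_vector riemannian_hessian_def)
  also have "\<dots> = (\<Sum>i\<in>UNIV. \<Sum>j\<in>UNIV. v $ i * v $ j * partial i (partial j f) x)
      + 1/2 * (\<Sum>i\<in>UNIV. \<Sum>j\<in>UNIV. \<Sum>b\<in>UNIV. v $ i * v $ j * w $ b * ?c i j b)"
    by (simp only: distrib_left sum.distrib sum_distrib_left ac_simps)
  \<comment> \<open>The weight \<open>v $ i * v $ j\<close> is symmetric, so exchanging the indices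
    yields the order of differentiation in which the Jacobian of a gradient appears.\<close>
  also have "(\<Sum>i\<in>UNIV. \<Sum>j\<in>UNIV. v $ i * v $ j * partial i (partial j f) x)
      = (\<Sum>i\<in>UNIV. \<Sum>j\<in>UNIV. v $ i * v $ j * partial j (partial i f) x)"
    by (subst sum.swap) (simp add: mult.commute)
  finally show ?thesis .
qed

text \<open>The product rule for \<open>M h = g\<close> expresses \<open>M ** A\<close> as the
  Jacobian of \<open>g\<close> minus derivatives of \<open>M\<close> contracted with
  \<open>h\<close>. The field \<open>g\<close> is arbitrary, so that a gradient with one block
  negated can be inserted.\<close>

lemma contraction_quadratic:
  fixes M :: "real^'k::finite \<Rightarrow> real^'k^'k" and h :: "real^'k \<Rightarrow> real \<Rightarrow> real^'k"
  assumes sym: "transpose (M z) = M z"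
    and M: "\<And>i j. (\<lambda>y. M y $ i $ j) differentiable (at z)"
    and h: "(\<lambda>y. h y t) differentiable (at z)"
    and eq: "\<And>y. M y *v h y t = g y"
  defines "A \<equiv> jacobian (\<lambda>y. h y t) (at z)"
  shows "v \<bullet> ((metric_rate h M z t + transpose A ** M z + M z ** A) *v v) =
    2 * (\<Sum>a\<in>UNIV. \<Sum>c\<in>UNIV. v $ a * v $ c * partial c (\<lambda>y. g y $ a) z)
    - (\<Sum>a\<in>UNIV. \<Sum>c\<in>UNIV. \<Sum>b\<in>UNIV. v $ a * v $ c * h z t $ b *
        (partial c (\<lambda>y. M y $ a $ b) z + partial a (\<lambda>y. M y $ c $ b) z - partial b (\<lambda>y. M y $ a $ c) z))"
    (is "_ = 2 * ?G - _")
proof -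
  let ?T = "\<lambda>F. \<Sum>a\<in>UNIV. \<Sum>c\<in>UNIV. \<Sum>b\<in>UNIV. v $ a * v $ c * h z t $ b * F a c b"
  have dg: "partial c (\<lambda>y. g y $ a) z =
      (\<Sum>b\<in>UNIV. h z t $ b * partial c (\<lambda>y. M y $ a $ b) z) + (M z ** A) $ a $ c" for a c
  proof -
    have "((\<lambda>y. h y t) has_derivative (\<lambda>u. A *v u)) (at z)"
      using h unfolding A_def jacobian_works .
    then have hb: "((\<lambda>y. h y t $ b) has_derivative (\<lambda>u. (A *v u) $ b)) (at z)" for b
      by (rule bounded_linear.has_derivative[OF bounded_linear_vec_nth])
    obtain D where D: "\<And>b. ((\<lambda>y. M y $ a $ b) has_derivative D b) (at z)"
      using M[of a] unfolding differentiable_def by metis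
    have "((\<lambda>y. \<Sum>b\<in>UNIV. M y $ a $ b * h y t $ b) has_derivative
        (\<lambda>u. \<Sum>b\<in>UNIV. M z $ a $ b * (A *v u) $ b + D b u * h z t $ b)) (at z)"
      by (intro has_derivative_sum has_derivative_mult D hb)
    then have "((\<lambda>y. g y $ a) has_derivative
        (\<lambda>u. \<Sum>b\<in>UNIV. M z $ a $ b * (A *v u) $ b + D b u * h z t $ b)) (at z)"
      by (simp add: eq[symmetric] matrix_vector_mult_def)
    from partial_eq[OF this] show ?thesis
      by (simp add: partial_eq[OF D] matrix_vector_mul_component inner_axis matrix_matrix_mult_def
          sum.distrib add.commute mult.commute)
  qed
  have MA: "v \<bullet> (M z ** A *v v) = ?G - ?T (\<lambda>a c b. partial c (\<lambda>y. M y $ a $ b) z)"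
    by (simp add: inner_matrix_vector dg distrib_left sum.distrib sum_distrib_left mult.assoc)
  \<comment> \<open>A matrix and its transpose have the same quadratic form, so both Jacobian terms
    contribute equally.\<close>
  have "v \<bullet> (transpose A ** M z *v v) = v \<bullet> (M z ** A *v v)"
  proof -
    have "transpose A ** M z = transpose (M z ** A)"
      by (simp add: matrix_transpose_mul sym)
    then show ?thesis
      by (metis dot_lmul_matrix inner_commute transpose_matrix_vector transpose_transpose)
  qed
  moreover have "v \<bullet> (metric_rate h M z t *v v) = ?T (\<lambda>a c b. partial b (\<lambda>y. M y $ a $ c) z)"
    by (simp add: inner_matrix_vector metric_rate_def sum_distrib_left ac_simps)
  \<comment> \<open>The two equal contributions become the two positive terms of the Christoffel
    symbol after exchanging \<open>a\<close> and \<open>c\<close> in one of them; the metric rate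
    supplies the third term.\<close>
  moreover have "?T (\<lambda>a c b. partial a (\<lambda>y. M y $ c $ b) z) = ?T (\<lambda>a c b. partial c (\<lambda>y. M y $ a $ b) z)"
    by (subst sum.swap) (simp add: mult.commute)
  moreover have "?T (\<lambda>a c b. partial c (\<lambda>y. M y $ a $ b) z + partial a (\<lambda>y. M y $ c $ b) z
      - partial b (\<lambda>y. M y $ a $ c) z) = ?T (\<lambda>a c b. partial c (\<lambda>y. M y $ a $ b) z)
        + ?T (\<lambda>a c b. partial a (\<lambda>y. M y $ c $ b) z) - ?T (\<lambda>a c b. partial b (\<lambda>y. M y $ a $ c) z)"
    by (simp only: distrib_left right_diff_distrib sum.distrib sum_subtractf)
  ultimately show ?thesis
    using MA by (simp add: matrix_vector_mult_add_rdistrib inner_add_right)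
qed

section \<open>Stacked vectors\<close>

lemma sum_UNIV_sum:
  "(\<Sum>i\<in>UNIV. f i) = (\<Sum>i\<in>UNIV. f (Inl i)) + (\<Sum>i\<in>UNIV. f (Inr i))"
  for f :: "'a::finite + 'b::finite \<Rightarrow> 'c::comm_monoid_add"
  by (subst UNIV_Plus_UNIV[symmetric], subst sum.Plus) simp_all

lemma stack_nth [simp]: "stack x l $ Inl a = x $ a" "stack x l $ Inr b = l $ b"
  by (simp_all add: stack_def)

lemma primal_nth [simp]: "primal z $ a = z $ Inl a" and dual_nth [simp]: "dual z $ b = z $ Inr b"
  by (simp_all add: primal_def dual_def)

lemma linear_primal: "linear primal" and linear_dual: "linear dual"
  by (auto intro!: linearI simp: vec_eq_iff)

lemma block_diag_nth [simp]:
  "block_diag P Q $ Inl a $ Inl c = P $ a $ c" "block_diag P Q $ Inl a $ Inr b = 0"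
  "block_diag P Q $ Inr b $ Inl a = 0" "block_diag P Q $ Inr b $ Inr d = Q $ b $ d"
  by (simp_all add: block_diag_def)

section \<open>Differentiation in the two blocks of variables\<close>

lemma partial_stack:
  "partial a (\<lambda>x. F (stack x l)) x = partial (Inl a) F (stack x l)"
  "partial b (\<lambda>l. F (stack x l)) l = partial (Inr b) F (stack x l)"
proof -
  have "stack x l + s *\<^sub>R axis (Inl a) 1 = stack (x + s *\<^sub>R axis a 1) l"
    "stack x l + s *\<^sub>R axis (Inr b) 1 = stack x (l + s *\<^sub>R axis b 1)" for s :: real
    by (auto simp: vec_eq_iff stack_def axis_def split: sum.splits)
  then show "partial a (\<lambda>x. F (stack x l)) x = partial (Inl a) F (stack x l)"
    "partial b (\<lambda>l. F (stack x l)) l = partial (Inr b) F (stack x l)"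
    by (simp_all add: partial_def)
qed

lemma partial_const [simp]: "partial i (\<lambda>x. c) x = 0"
  by (simp add: partial_def)

text \<open>A function of the primal block alone is constant along every dual axis;
  \<open>partial_stack\<close> is applied with \<open>z\<close> split into its blocks.\<close>

lemma partial_primal [simp]:
  "partial (Inl a) (\<lambda>z. f (primal z)) z = partial a f (primal z)"
  "partial (Inr b) (\<lambda>z. f (primal z)) z = 0"
  using partial_stack(1)[of a "\<lambda>z. f (primal z)" "dual z" "primal z"]
    partial_stack(2)[of b "\<lambda>z. f (primal z)" "primal z" "dual z"] by simp_all

lemma partial_dual [simp]:
  "partial (Inl a) (\<lambda>z. f (dual z)) z = 0"
  "partial (Inr b) (\<lambda>z. f (dual z)) z = partial b f (dual z)"
  using partial_stack(1)[of a "\<lambda>z. f (dual z)" "dual z" "primal z"]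
    partial_stack(2)[of b "\<lambda>z. f (dual z)" "primal z" "dual z"] by simp_all

lemma C1_fun_const [simp]: "C1_fun (\<lambda>x. c)"
  by (simp add: C1_fun_def)

lemma C1_fun_primal:
  fixes f :: "real^'n::finite \<Rightarrow> real"
  assumes "C1_fun f"
  shows "C1_fun (\<lambda>z::real^('n + 'm::finite). f (primal z))"
  unfolding C1_fun_def
proof (intro conjI allI)
  show "(\<lambda>z::real^('n + 'm). f (primal z)) differentiable (at z)" for z
    using assms differentiable_compose[of f primal]
    by (simp add: C1_fun_def linear_imp_differentiable linear_primal)
  show "continuous_on UNIV (partial i (\<lambda>z::real^('n + 'm). f (primal z)))" for i
  proof (cases i)
    case (Inl a)
    have "continuous_on UNIV (\<lambda>z::real^('n + 'm). partial a f (primal z))"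
      using assms continuous_on_compose2[of UNIV "partial a f" UNIV primal]
      by (simp add: C1_fun_def linear_continuous_on linear_primal linear_linear)
    then show ?thesis by (simp add: Inl cong: continuous_on_cong)
  next
    case (Inr b)
    then show ?thesis by (simp cong: continuous_on_cong)
  qed
qed

lemma C1_fun_dual:
  fixes f :: "real^'m::finite \<Rightarrow> real"
  assumes "C1_fun f"
  shows "C1_fun (\<lambda>z::real^('n::finite + 'm). f (dual z))"
  unfolding C1_fun_def
proof (intro conjI allI)
  show "(\<lambda>z::real^('n + 'm). f (dual z)) differentiable (at z)" for z
    using assms differentiable_compose[of f dual]
    by (simp add: C1_fun_def linear_imp_differentiable linear_dual)
  show "continuous_on UNIV (partial i (\<lambda>z::real^('n + 'm). f (dual z)))" for i
  proof (cases i)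
    case (Inl a)
    then show ?thesis by (simp cong: continuous_on_cong)
  next
    case (Inr b)
    have "continuous_on UNIV (\<lambda>z::real^('n + 'm). partial b f (dual z))"
      using assms continuous_on_compose2[of UNIV "partial b f" UNIV dual]
      by (simp add: C1_fun_def linear_continuous_on linear_dual linear_linear)
    then show ?thesis by (simp add: Inr cong: continuous_on_cong)
  qed
qed

section \<open>The block-diagonal metric\<close>

lemma block_diag_quadratic:
  "v \<bullet> (block_diag P Q *v v) = primal v \<bullet> (P *v primal v) + dual v \<bullet> (Q *v dual v)"
  by (simp add: inner_matrix_vector sum_UNIV_sum)

lemma pos_def_block_diag:
  assumes "pos_def P" "pos_def Q"
  shows "pos_def (block_diag P Q)"
  unfolding pos_def_def block_diag_quadratic
proof (intro conjI allI impI)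
  have "P $ b $ a = P $ a $ b" "Q $ d $ c = Q $ c $ d" for a b c d
    using assms unfolding pos_def_def transpose_def vec_eq_iff by (metis vec_lambda_beta)+
  then show "transpose (block_diag P Q) = block_diag P Q"
    by (simp add: vec_eq_iff transpose_def block_diag_def split: sum.splits)
  fix v :: "real^('a + 'b)"
  assume "v \<noteq> 0"
  then have "primal v \<noteq> 0 \<or> dual v \<noteq> 0"
    by (metis linear_0 linear_primal linear_dual stack_primal_dual)
  \<comment> \<open>One of the two blocks of \<open>v\<close> may vanish, so strict positivity of
    one term is combined with nonnegativity of the other.\<close>
  moreover have "0 \<le> u \<bullet> (P *v u)" "0 \<le> w \<bullet> (Q *v w)" for u w
    using assms unfolding pos_def_def by (metis inner_zero_left less_imp_le order_refl)+
  ultimately show "0 < primal v \<bullet> (P *v primal v) + dual v \<bullet> (Q *v dual v)"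
    using assms unfolding pos_def_def by (metis add_pos_nonneg add_nonneg_pos)
qed

lemma riemannian_metric_block_diag:
  assumes "riemannian_metric P" "riemannian_metric Q"
  shows "riemannian_metric (\<lambda>z. block_diag (P (primal z)) (Q (dual z)))"
  unfolding riemannian_metric_def
proof (intro conjI allI)
  show "pos_def (block_diag (P (primal z)) (Q (dual z)))" for z
    using assms by (auto simp: riemannian_metric_def intro: pos_def_block_diag)
  show "C1_fun (\<lambda>z. block_diag (P (primal z)) (Q (dual z)) $ i $ j)" for i j
    using assms C1_fun_primal[of "\<lambda>x. P x $ a $ b" for a b] C1_fun_dual[of "\<lambda>x. Q x $ a $ b" for a b]
    by (cases i; cases j) (simp_all add: riemannian_metric_def)
qed

section \<open>Primal-dual dynamics\<close>

text \<open>The gradient with its primal block negated: the right-hand side of the primal-dual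
  dynamics in the stacked state.\<close>

definition saddle_grad :: "(real^('n::finite + 'm::finite) \<Rightarrow> real) \<Rightarrow> real^('n + 'm) \<Rightarrow> real^('n + 'm)" where
  "saddle_grad F z = (\<chi> i. case i of Inl a \<Rightarrow> - partial i F z | Inr b \<Rightarrow> partial i F z)"

lemma saddle_grad_nth [simp]:
  "saddle_grad F z $ Inl a = - partial (Inl a) F z" "saddle_grad F z $ Inr b = partial (Inr b) F z"
  by (simp_all add: saddle_grad_def)

lemma block_diag_mult: "block_diag P Q *v z = stack (P *v primal z) (Q *v dual z)"
proof -
  have "(block_diag P Q *v z) $ i = stack (P *v primal z) (Q *v dual z) $ i" for i
    by (cases i) (simp_all add: matrix_vector_mult_def sum_UNIV_sum)
  then show ?thesis by (simp add: vec_eq_iff)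
qed

text \<open>Merges the two implicit equations into a single system \<open>M h = g\<close>, the form
  required by \<open>differentiable_linear_solution\<close> and
  \<open>contraction_quadratic\<close>.\<close>

lemma primal_dual_field_saddle_grad:
  assumes "primal_dual_field Mx Ml L h"
  shows "block_diag (Mx (primal z)) (Ml (dual z)) *v h z t
    = saddle_grad (\<lambda>z. L (primal z) (dual z) t) z"
proof -
  have "Mx (primal z) *v primal (h z t) = - grad (\<lambda>y. L y (dual z) t) (primal z)"
    and "Ml (dual z) *v dual (h z t) = grad (\<lambda>k. L (primal z) k t) (dual z)"
    using assms unfolding primal_dual_field_def by (metis stack_primal_dual)+
  moreover have "saddle_grad (\<lambda>z. L (primal z) (dual z) t) z =
      stack (- grad (\<lambda>y. L y (dual z) t) (primal z)) (grad (\<lambda>k. L (primal z) k t) (dual z))" (is "?s = ?r")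
  proof -
    have "?s $ i = ?r $ i" for i
      using partial_stack(1)[of _ "\<lambda>z. L (primal z) (dual z) t" "dual z" "primal z"]
        partial_stack(2)[of _ "\<lambda>z. L (primal z) (dual z) t" "primal z" "dual z"]
      by (cases i) (simp_all add: grad_def)
    then show ?thesis by (simp add: vec_eq_iff)
  qed
  ultimately show ?thesis
    by (simp add: block_diag_mult)
qed

lemma primal_dual_field_differentiable:
  assumes L: "C2_fun (\<lambda>z. L (primal z) (dual z) t)"
    and Mx: "riemannian_metric Mx" and Ml: "riemannian_metric Ml"
    and dyn: "primal_dual_field Mx Ml L h"
  shows "(\<lambda>y. h y t) differentiable (at z)"
proof (rule differentiable_linear_solution)
  let ?M = "\<lambda>z. block_diag (Mx (primal z)) (Ml (dual z))"
  have M: "riemannian_metric ?M"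
    using Mx Ml by (rule riemannian_metric_block_diag)
  then show "(\<lambda>y. ?M y $ i $ j) differentiable (at z)" for i j
    by (simp add: riemannian_metric_def C1_fun_def)
  show "invertible (?M y)" for y
    using M by (simp add: riemannian_metric_def pos_def_imp_invertible)
  show "?M y *v h y t = saddle_grad (\<lambda>z. L (primal z) (dual z) t) y" for y
    using dyn by (rule primal_dual_field_saddle_grad)
  show "(\<lambda>y. saddle_grad (\<lambda>z. L (primal z) (dual z) t) y $ i) differentiable (at z)" for i
    using L by (cases i) (simp_all add: C2_fun_def C1_fun_def)
qed

text \<open>An exact identity, to be estimated only afterwards. The two blocks decouple because each
  metric depends on its own variables and the mixed derivatives of \<open>L\<close> cancel.\<close>

lemma primal_dual_quadratic:
  fixes L :: "real^'n::finite \<Rightarrow> real^'m::finite \<Rightarrow> real \<Rightarrow> real" and z :: "real^('n + 'm)"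
  assumes L: "C2_fun (\<lambda>z. L (primal z) (dual z) t)"
    and Mx: "riemannian_metric Mx" and Ml: "riemannian_metric Ml"
    and dyn: "primal_dual_field Mx Ml L h"
  defines "M \<equiv> \<lambda>z. block_diag (Mx (primal z)) (Ml (dual z))"
    and "A \<equiv> jacobian (\<lambda>y. h y t) (at z)"
  shows "v \<bullet> ((metric_rate h M z t + transpose A ** M z + M z ** A) *v v) =
    - 2 * (primal v \<bullet> (riemannian_hessian Mx (\<lambda>x. L x (dual z) t) (primal z) *v primal v))
    - 2 * (dual v \<bullet> (riemannian_hessian Ml (\<lambda>l. - L (primal z) l t) (dual z) *v dual v))"
proof -
  define F where "F = (\<lambda>z. L (primal z) (dual z) t)"
  define x where "x = primal z"
  define l where "l = dual z"
  define w where "w = h z t"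
  define f where "f = (\<lambda>x. L x l t)"
  \<comment> \<open>With the sign of \<open>L\<close> reversed, the dual ascent is a descent for
    \<open>g\<close>, so \<open>riemannian_hessian_quadratic\<close> covers both blocks.\<close>
  define g where "g = (\<lambda>l. - L x l t)"
  have z: "stack x l = z" by (simp add: x_def l_def)
  have F: "F differentiable (at y)" "partial i F differentiable (at y)"
    "partial i (partial j F) y = partial j (partial i F) y" for i j y
    using L partial_commute[of F] by (simp_all add: F_def C2_fun_def C1_fun_def)
  have M: "riemannian_metric M"
    unfolding M_def using Mx Ml by (rule riemannian_metric_block_diag)
  have "partial a f = (\<lambda>x. partial (Inl a) F (stack x l))" for a
    using partial_stack(1)[of a F l] by (simp add: f_def F_def fun_eq_iff)
  then have ff: "partial c (partial a f) x = partial (Inl c) (partial (Inl a) F) z" for a c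
    using partial_stack(1)[of c "partial (Inl a) F" l x] by (simp add: z)
  have g': "partial b g = (\<lambda>l. - partial (Inr b) F (stack x l))" for b
    using partial_stack(2)[of b "\<lambda>z. - F z" x] partial_uminus[OF F(1)]
    by (simp add: g_def F_def fun_eq_iff)
  then have gg: "partial d (partial b g) l = - partial (Inr d) (partial (Inr b) F) z" for b d
    using partial_stack(2)[of d "\<lambda>z. - partial (Inr b) F z" x l] partial_uminus[OF F(2)]
    by (simp add: z)
  have dyn': "M y *v h y t = saddle_grad F y" for y
    using dyn unfolding M_def F_def by (rule primal_dual_field_saddle_grad)
  have wx: "Mx x *v primal w = - grad f x"
    using dyn unfolding primal_dual_field_def f_def w_def by (metis z)
  have "Ml l *v dual w = grad (\<lambda>l. L x l t) l"
    using dyn unfolding primal_dual_field_def w_def by (metis z)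
  moreover have "grad (\<lambda>l. L x l t) l = - grad g l"
    using partial_stack(2)[of _ F x l] by (simp add: grad_def vec_eq_iff g' F_def)
  ultimately have wl: "Ml l *v dual w = - grad g l" by simp
  define C where "C = (\<lambda>a c b. partial c (\<lambda>y. M y $ a $ b) z + partial a (\<lambda>y. M y $ c $ b) z
    - partial b (\<lambda>y. M y $ a $ c) z)"
  define Cx where "Cx = (\<lambda>a c b. partial c (\<lambda>y. Mx y $ a $ b) x + partial a (\<lambda>y. Mx y $ c $ b) x
    - partial b (\<lambda>y. Mx y $ a $ c) x)"
  define Cl where "Cl = (\<lambda>a c b. partial c (\<lambda>y. Ml y $ a $ b) l + partial a (\<lambda>y. Ml y $ c $ b) l
    - partial b (\<lambda>y. Ml y $ a $ c) l)"
  note Mx_partial = partial_primal[of _ "\<lambda>y. Mx y $ i $ j" for i j]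
    and Ml_partial = partial_dual[of _ "\<lambda>y. Ml y $ i $ j" for i j]
  \<comment> \<open>With mixed indices, every term is a derivative of a zero block or of a metric
    block in the variables of the other block.\<close>
  have C: "C (Inl a) (Inl c) (Inl b) = Cx a c b" "C (Inr a') (Inr c') (Inr b') = Cl a' c' b'"
    "C (Inl a) (Inl c) (Inr b') = 0" "C (Inl a) (Inr c') (Inl b) = 0" "C (Inr a') (Inl c) (Inl b) = 0"
    "C (Inl a) (Inr c') (Inr b') = 0" "C (Inr a') (Inl c) (Inr b') = 0" "C (Inr a') (Inr c') (Inl b) = 0"
    for a c b a' c' b'
    by (simp_all add: C_def Cx_def Cl_def M_def Mx_partial Ml_partial x_def l_def)
  let ?D = "\<lambda>a c. partial c (partial a F) z"
  \<comment> \<open>By Schwarz's theorem the two mixed sums agree; \<open>saddle_grad\<close> gives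
    them opposite signs.\<close>
  have cross: "(\<Sum>a\<in>UNIV. \<Sum>c\<in>UNIV. v $ Inr a * v $ Inl c * ?D (Inr a) (Inl c))
      = (\<Sum>a\<in>UNIV. \<Sum>c\<in>UNIV. v $ Inl a * v $ Inr c * ?D (Inl a) (Inr c))"
    by (subst sum.swap) (simp add: F(3)[of "Inl _"] mult.commute)
  have "v \<bullet> ((metric_rate h M z t + transpose A ** M z + M z ** A) *v v) =
    2 * (\<Sum>a\<in>UNIV. \<Sum>c\<in>UNIV. v $ a * v $ c * partial c (\<lambda>y. saddle_grad F y $ a) z)
    - (\<Sum>a\<in>UNIV. \<Sum>c\<in>UNIV. \<Sum>b\<in>UNIV. v $ a * v $ c * w $ b * C a c b)"
    unfolding C_def A_def w_def
  proof (rule contraction_quadratic)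
    show "transpose (M z) = M z" "(\<lambda>y. M y $ i $ j) differentiable (at z)" for i j
      using M by (simp_all add: riemannian_metric_def pos_def_def C1_fun_def)
    show "(\<lambda>y. h y t) differentiable (at z)"
      using L Mx Ml dyn by (rule primal_dual_field_differentiable)
  qed (rule dyn')
  also have "(\<Sum>a\<in>UNIV. \<Sum>c\<in>UNIV. v $ a * v $ c * partial c (\<lambda>y. saddle_grad F y $ a) z)
      = - (\<Sum>a\<in>UNIV. \<Sum>c\<in>UNIV. v $ Inl a * v $ Inl c * ?D (Inl a) (Inl c))
        + (\<Sum>a\<in>UNIV. \<Sum>c\<in>UNIV. v $ Inr a * v $ Inr c * ?D (Inr a) (Inr c))"
    using cross by (simp add: sum_UNIV_sum partial_uminus[OF F(2)] sum.distrib sum_negf)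
  also have "(\<Sum>a\<in>UNIV. \<Sum>c\<in>UNIV. \<Sum>b\<in>UNIV. v $ a * v $ c * w $ b * C a c b)
      = (\<Sum>a\<in>UNIV. \<Sum>c\<in>UNIV. \<Sum>b\<in>UNIV. v $ Inl a * v $ Inl c * w $ Inl b * Cx a c b)
        + (\<Sum>a\<in>UNIV. \<Sum>c\<in>UNIV. \<Sum>b\<in>UNIV. v $ Inr a * v $ Inr c * w $ Inr b * Cl a c b)"
    by (simp add: sum_UNIV_sum C)
  moreover have "primal v \<bullet> (riemannian_hessian Mx f x *v primal v) =
      (\<Sum>a\<in>UNIV. \<Sum>c\<in>UNIV. v $ Inl a * v $ Inl c * ?D (Inl a) (Inl c))
      + 1/2 * (\<Sum>a\<in>UNIV. \<Sum>c\<in>UNIV. \<Sum>b\<in>UNIV. v $ Inl a * v $ Inl c * w $ Inl b * Cx a c b)"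
    using riemannian_hessian_quadratic[where M = Mx, OF _ wx, of "primal v"] Mx
    by (simp add: riemannian_metric_def ff Cx_def)
  moreover have "dual v \<bullet> (riemannian_hessian Ml g l *v dual v) =
      - (\<Sum>a\<in>UNIV. \<Sum>c\<in>UNIV. v $ Inr a * v $ Inr c * ?D (Inr a) (Inr c))
      + 1/2 * (\<Sum>a\<in>UNIV. \<Sum>c\<in>UNIV. \<Sum>b\<in>UNIV. v $ Inr a * v $ Inr c * w $ Inr b * Cl a c b)"
    using riemannian_hessian_quadratic[where M = Ml, OF _ wl, of "dual v"] Ml
    by (simp add: riemannian_metric_def gg Cl_def sum_negf)
  ultimately show ?thesis
    unfolding f_def g_def x_def l_def by (simp add: algebra_simps)
qed

section \<open>From the quadratic identity to contraction\<close>

text \<open>The order \<open>\<preceq>\<close> includes symmetry of the difference, so a bound on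
  quadratic forms must be complemented by this. Transposition exchanges the two Jacobian
  terms.\<close>

lemma transpose_contraction_matrix:
  assumes "\<And>y. transpose (M y) = M y"
  shows "transpose (metric_rate h M z t + transpose A ** M z + M z ** A)
    = metric_rate h M z t + transpose A ** M z + M z ** A"
proof -
  have "M y $ j $ i = M y $ i $ j" for y i j
    using assms unfolding transpose_def vec_eq_iff by (metis vec_lambda_beta)
  then have "transpose (metric_rate h M z t) = metric_rate h M z t"
    by (simp add: metric_rate_def transpose_def)
  moreover have "transpose (X + Y) = transpose X + transpose Y" for X Y :: "real^'a^'a"
    by (simp add: transpose_def vec_eq_iff)
  ultimately show ?thesis
    by (simp add: matrix_transpose_mul assms add_ac)
qed

lemma geodesically_strongly_convexD:
  assumes "geodesically_strongly_convex \<alpha> M f"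
  shows "\<alpha> * (v \<bullet> (M x *v v)) \<le> v \<bullet> (riemannian_hessian M f x *v v)"
proof -
  have "0 \<le> v \<bullet> ((riemannian_hessian M f x - \<alpha> *\<^sub>R M x) *v v)"
    using assms by (simp add: geodesically_strongly_convex_def loewner_le_def pos_semidef_def)
  then show ?thesis
    by (simp add: matrix_vector_mult_diff_rdistrib inner_diff_right scaleR_matrix_vector_assoc[symmetric])
qed

theorem theorem5:
  fixes L :: "real^'n::finite \<Rightarrow> real^'m::finite \<Rightarrow> real \<Rightarrow> real"
    and Mx :: "real^'n \<Rightarrow> real^'n^'n"
    and Ml :: "real^'m \<Rightarrow> real^'m^'m"
    and h :: "real^('n + 'm) \<Rightarrow> real \<Rightarrow> real^('n + 'm)"
  assumes L_smooth: "\<And>t. C2_fun (\<lambda>z. L (primal z) (dual z) t)"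
    and Mx_metric: "riemannian_metric Mx"
    and Ml_metric: "riemannian_metric Ml"
    and L_convex: "\<exists>\<alpha>\<^sub>1>0. \<forall>l t. geodesically_strongly_convex \<alpha>\<^sub>1 Mx (\<lambda>x. L x l t)"
    and L_concave: "\<exists>\<alpha>\<^sub>2>0. \<forall>x t. geodesically_strongly_convex \<alpha>\<^sub>2 Ml (\<lambda>l. - L x l t)"
    and dynamics: "primal_dual_field Mx Ml L h"
  shows "contracting h (\<lambda>z. block_diag (Mx (primal z)) (Ml (dual z)))"
proof -
  let ?M = "\<lambda>z. block_diag (Mx (primal z)) (Ml (dual z))"
  obtain \<alpha>\<^sub>1 \<alpha>\<^sub>2 where \<alpha>: "0 < \<alpha>\<^sub>1" "0 < \<alpha>\<^sub>2"
    and convex: "\<And>l t. geodesically_strongly_convex \<alpha>\<^sub>1 Mx (\<lambda>x. L x l t)"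
    and concave: "\<And>x t. geodesically_strongly_convex \<alpha>\<^sub>2 Ml (\<lambda>l. - L x l t)"
    using L_convex L_concave by metis
  \<comment> \<open>The smaller constant bounds both Hessians below. The factor 2 in the quadratic
    identity matches the one in the contraction inequality, so it is itself the rate.\<close>
  define \<alpha> where "\<alpha> = min \<alpha>\<^sub>1 \<alpha>\<^sub>2"
  have M: "riemannian_metric ?M"
    using Mx_metric Ml_metric by (rule riemannian_metric_block_diag)
  then have sym: "transpose (?M y) = ?M y" for y
    by (simp add: riemannian_metric_def pos_def_def)
  have nonneg: "0 \<le> u \<bullet> (Mx x *v u)" "0 \<le> w \<bullet> (Ml l *v w)" for u w x l
    using Mx_metric Ml_metric unfolding riemannian_metric_def pos_def_def
    by (metis inner_zero_left less_imp_le order_refl)+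
  have "metric_rate h ?M z t + transpose A ** ?M z + ?M z ** A \<preceq> (- 2 * \<alpha>) *\<^sub>R ?M z"
    if A: "A = jacobian (\<lambda>y. h y t) (at z)" for z t A
    unfolding loewner_le_def pos_semidef_def
  proof (intro conjI allI)
    let ?S = "metric_rate h ?M z t + transpose A ** ?M z + ?M z ** A"
    have "transpose (c *\<^sub>R X - Y) = c *\<^sub>R transpose X - transpose Y" for c and X Y :: "real^('n + 'm)^('n + 'm)"
      by (simp add: transpose_def vec_eq_iff)
    then show "transpose ((- 2 * \<alpha>) *\<^sub>R ?M z - ?S) = (- 2 * \<alpha>) *\<^sub>R ?M z - ?S"
      by (simp only: sym transpose_contraction_matrix[of ?M, OF sym])
    fix v
    let ?x = "primal v \<bullet> (Mx (primal z) *v primal v)" and ?l = "dual v \<bullet> (Ml (dual z) *v dual v)"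
    \<comment> \<open>Lowering the constants to their minimum preserves the bounds because both
      metric forms are nonnegative.\<close>
    have "\<alpha> * ?x \<le> \<alpha>\<^sub>1 * ?x" "\<alpha> * ?l \<le> \<alpha>\<^sub>2 * ?l"
      using nonneg by (auto intro!: mult_right_mono simp: \<alpha>_def)
    moreover note geodesically_strongly_convexD[OF convex, of "primal v" "primal z" "dual z" t]
      geodesically_strongly_convexD[OF concave, of "dual v" "dual z" "primal z" t]
    ultimately have "v \<bullet> (?S *v v) \<le> - 2 * (\<alpha> * ?x) - 2 * (\<alpha> * ?l)"
      unfolding A primal_dual_quadratic[OF L_smooth Mx_metric Ml_metric dynamics] by linarith
    moreover have "v \<bullet> (((- 2 * \<alpha>) *\<^sub>R ?M z - ?S) *v v) = (- 2 * \<alpha>) * (?x + ?l) - v \<bullet> (?S *v v)"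
      by (simp only: matrix_vector_mult_diff_rdistrib inner_diff_right inner_scaleR_right
          scaleR_matrix_vector_assoc[symmetric] block_diag_quadratic)
    ultimately show "0 \<le> v \<bullet> (((- 2 * \<alpha>) *\<^sub>R ?M z - ?S) *v v)"
      by (simp add: algebra_simps)
  qed
  moreover have "0 < \<alpha>"
    using \<alpha> by (simp add: \<alpha>_def)
  moreover have "(\<lambda>y. h y t) differentiable (at z)" for z t
    using L_smooth Mx_metric Ml_metric dynamics by (rule primal_dual_field_differentiable)
  ultimately show ?thesis
    using M unfolding contracting_def Let_def by blast
qed

end
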